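(* Let $$c_1:=2\sum_{y=1}^\infty \bigl|\mathrm{INF}(y,t_{\max}(y))\bigr|,\qquad t_{\max}(y):=\Bigl\lfloor \tfrac{y^2-4}{3}\Bigr\rfloor+2 ,$$ which is a convergent series. The constant $c_1$ is best possible in the bound $|f(x,t)-E(x,t)|\le c_1$ for even initial configurations of the Propp machine on $\mathbb{Z}$: for every real $c<c_1$ there exist an even initial configuration, a time $t\in\mathbb{N}_0$ and a location $x\in\mathbb{Z}$ such that $|f(x,t)-E(x,t)|>c$.
   Context: $\mathbb{N}_0$ is the set of non-negative integers. For integers $m,n$ write $m\sim n$ if $m-n$ is even. Propp machine on $\mathbb{Z}$: at each time $t\in\mathbb{N}_0$, each vertex $x\in\mathbb{Z}$ holds a number $f(x,t)\in\mathbb{N}_0$ of chips and an arrow $\mathrm{ARR}(x,t)\in\{-1,+1\}$ ($+1$ = right, $-1$ = left). The initial configuration (the values $f(x,0)$ and $\mathrm{ARR}(x,0)$, $x\in\mathbb{Z}$; infinitely many vertices may hold chips) determines all later configurations by $$f(x,t+1)=\tfrac12 f(x-1,t)+\tfrac12 f(x+1,t)+\tfrac12\mathrm{ARR}(x-1,t)\,(f(x-1,t)\bmod 2)-\tfrac12\mathrm{ARR}(x+1,t)\,(f(x+1,t)\bmod 2),$$ $$\mathrm{ARR}(x,t+1)=(-1)^{f(x,t)}\,\mathrm{ARR}(x,t).$$ A configuration is even if no chip is at an odd position (arrows are unrestricted). For $x\in\mathbb{Z}$ and $t\ge 0$, $H(x,t)$ is the probability that a simple random walk on $\mathbb{Z}$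 started at $0$ is at $x$ at time $t$: $H(x,t)=2^{-t}\binom{t}{(t+x)/2}$ if $t\sim x$ (which is $0$ if $|x|>t$), and $H(x,t)=0$ otherwise. For $t>0$, $\mathrm{INF}(y,t):=H(y+1,t-1)-H(y,t)$. $E(x,t)$ is the expected number of chips at $x$ after all chips of the initial configuration perform independent simple random walks for $t$ steps, i.e. $E(x,t)=\sum_{y\in\mathbb{Z}}f(y,0)\,H(x-y,t)$ (a finite sum). *)

theory Defs
  imports "HOL-Analysis.Analysis"
begin

text \<open>
  A run of the Propp machine on the integers: \<open>f x t\<close> is the number of chips and \<open>ARR x t\<close> the
  arrow at vertex \<open>x\<close> at time \<open>t\<close>.  Its initial configuration is \<open>\<lambda>x. f x 0\<close> together with
  \<open>\<lambda>x. ARR x 0\<close>, which determines the whole run.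
\<close>

definition propp_run :: "(int \<Rightarrow> nat \<Rightarrow> nat) \<Rightarrow> (int \<Rightarrow> nat \<Rightarrow> int) \<Rightarrow> bool" where
  "propp_run f ARR \<longleftrightarrow>
     (\<forall>x t. ARR x t \<in> {-1, 1}) \<and>
     (\<forall>x t. real (f x (t + 1)) =
        1/2 * real (f (x - 1) t) + 1/2 * real (f (x + 1) t)
        + 1/2 * real_of_int (ARR (x - 1) t) * real (f (x - 1) t mod 2)
        - 1/2 * real_of_int (ARR (x + 1) t) * real (f (x + 1) t mod 2)) \<and>
     (\<forall>x t. ARR x (t + 1) = (-1) ^ f x t * ARR x t)"

definition even_config :: "(int \<Rightarrow> nat) \<Rightarrow> bool" where
  "even_config g \<longleftrightarrow> (\<forall>x. odd x \<longrightarrow> g x = 0)"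

text \<open>
  The guard \<open>\<bar>x\<bar> \<le> int t\<close> is needed because \<open>nat\<close> truncates: for \<open>x < - int t\<close> the binomial
  coefficient below would be \<open>t choose 0 = 1\<close> rather than \<open>0\<close>.
\<close>

definition H :: "int \<Rightarrow> nat \<Rightarrow> real" where
  "H x t = (if even (int t - x) \<and> \<bar>x\<bar> \<le> int t
            then real (t choose nat ((int t + x) div 2)) / 2 ^ t else 0)"

text \<open>The quantity \<open>INF(y,t)\<close>; only meaningful for \<open>t > 0\<close>.\<close>

definition influence :: "int \<Rightarrow> nat \<Rightarrow> real" where
  "influence y t = H (y + 1) (t - 1) - H y t"

definition expected_chips :: "(int \<Rightarrow> nat) \<Rightarrow> int \<Rightarrow> nat \<Rightarrow> real" where
  "expected_chips g x t = (\<Sum>\<^sub>\<infinity>y\<in>UNIV. real (g y) * H (x - y) t)"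

text \<open>For \<open>y \<ge> 1\<close> the integer under \<open>nat\<close> is positive, so nothing is truncated.\<close>

definition t_max :: "nat \<Rightarrow> nat" where
  "t_max y = nat (\<lfloor>((real y)\<^sup>2 - 4) / 3\<rfloor> + 2)"

definition c1_term :: "nat \<Rightarrow> real" where
  "c1_term y = \<bar>influence (int y) (t_max y)\<bar>"

definition c1 :: real where
  "c1 = 2 * (\<Sum>n. c1_term (Suc n))"

end

theory Submission
  imports Defs
begin

text \<open>
  An even pile splits exactly as the random walk would; an odd pile sends its extra chip where the
  arrow points.  Telescoping over time, with all chips walking randomly from time \<open>s\<close> on, therefore
  gives (lemma \<open>discrepancy\<close>)
  \<open>f(x,t) - E(x,t) = - (\<Sum> ARR(y,s) INF(x - y, t - s))\<close>, the sum being over those \<open>(y,s)\<close> with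
  \<open>s < t\<close> at which the pile is odd.

  The set of these \<open>(y,s)\<close> can be prescribed at will in any finite region of space-time, apart from
  the constraint \<open>y \<sim> s\<close> inherent to even configurations (lemma \<open>parity_forcing\<close>).  Indeed,
  \<open>2^T\<close> further chips at a vertex \<open>v\<close> split evenly for \<open>T\<close> steps, hence change no parity before time
  \<open>T\<close>, no arrow up to time \<open>T\<close>, and at time \<open>T\<close> add a row of binomial coefficients whose leftmost
  entry, at \<open>v - T\<close>, is \<open>1\<close>.  So the parities of time \<open>T\<close> can be corrected from left to right.

  Now look at \<open>x = 0\<close> and a large even \<open>t\<close>, let the initial arrows point towards \<open>0\<close>, and let the
  vertices \<open>y\<close> with \<open>1 \<le> \<bar>y\<bar> \<le> L\<close> be odd exactly once before time \<open>t\<close>, namely at time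
  \<open>t - t_max \<bar>y\<bar>\<close>; this time has the parity of \<open>y\<close> because \<open>t_max \<bar>y\<bar> \<sim> y\<close>.  All arrows
  still have their initial direction when they matter, all contributions are positive, and the
  discrepancy is twice the \<open>L\<close>-th partial sum of the series defining \<open>c1\<close>
  (lemma \<open>attain_partial_sum\<close>).

  The series converges since \<open>\<bar>INF(y,t)\<bar> = (y / t) H(y,t)\<close>, where \<open>H(y,t) \<le> 1 / sqrt t\<close> and
  \<open>t_max y\<close> is at least \<open>y^2 / 4\<close>, which makes the terms \<open>O(1 / y^2)\<close>.
\<close>

section \<open>Counting walks\<close>

text \<open>
  The numbers \<open>2^n H(d,n)\<close> as natural numbers: parity arguments need integrality, and Pascal's
  recursion holds for them at every integer \<open>d\<close> without case distinctions.
\<close>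

fun walks :: "nat \<Rightarrow> int \<Rightarrow> nat" where
  "walks 0 d = (if d = 0 then 1 else 0)"
| "walks (Suc n) d = walks n (d - 1) + walks n (d + 1)"

lemma walks_outside: "\<bar>d\<bar> > int n \<Longrightarrow> walks n d = 0"
  by (induction n arbitrary: d) auto

lemma walks_leftmost: "walks n (- int n) = 1"
proof (induction n)
  case (Suc n)
  have "walks n (- int (Suc n) - 1) = 0" by (rule walks_outside) simp
  moreover have "- int (Suc n) + 1 = - int n" by simp
  ultimately show ?case using Suc by (simp only: walks.simps)
qed simp

lemma walks_parity: "odd (int n - d) \<Longrightarrow> walks n d = 0"
  by (induction n arbitrary: d) auto

lemma walks_minus: "walks n (- d) = walks n d"
proof (induction n arbitrary: d)
  case (Suc n)
  have "walks n (- d - 1) = walks n (d + 1)" "walks n (- d + 1) = walks n (d - 1)"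
    using Suc[of "d + 1"] Suc[of "d - 1"] by (simp_all add: minus_diff_commute add.commute)
  then show ?case by simp
qed simp

lemma walks_binomial: "k \<le> n \<Longrightarrow> walks n (2 * int k - int n) = n choose k"
proof (induction n arbitrary: k)
  case (Suc n)
  show ?case
  proof (cases k)
    case 0
    then show ?thesis using walks_leftmost[of "Suc n"] by simp
  next
    case (Suc j)
    have e: "2 * int k - int (Suc n) - 1 = 2 * int j - int n"
      "2 * int k - int (Suc n) + 1 = 2 * int k - int n" using Suc by simp_all
    have 1: "walks n (2 * int j - int n) = n choose j"
      using Suc.IH[of j] Suc.prems Suc by simp
    have 2: "walks n (2 * int k - int n) = n choose k"
    proof (cases "k \<le> n")
      case True
      then show ?thesis by (rule Suc.IH)
    next
      case False
      then show ?thesis using walks_outside[of n "2 * int k - int n"] by (simp add: binomial_eq_0)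
    qed
    show ?thesis unfolding walks.simps e 1 2 by (simp add: Suc)
  qed
qed simp

lemma H_eq_walks: "H d n = real (walks n d) / 2 ^ n"
proof (cases "even (int n - d) \<and> \<bar>d\<bar> \<le> int n")
  case True
  define k where "k = nat ((int n + d) div 2)"
  have "d = 2 * int k - int n" "k \<le> n" using True by (auto simp: k_def)
  then have "walks n d = n choose k" using walks_binomial by blast
  then show ?thesis using True by (simp add: H_def k_def)
next
  case False
  then have "walks n d = 0" using walks_outside walks_parity by (metis not_le)
  then show ?thesis using False by (auto simp add: H_def)
qed

lemma H_nonneg: "H d n \<ge> 0"
  by (simp add: H_eq_walks)

lemma H_Suc: "H d (Suc n) = (H (d - 1) n + H (d + 1) n) / 2"
  by (simp add: H_eq_walks field_simps)

lemma H_outside: "\<bar>d\<bar> > int n \<Longrightarrow> H d n = 0"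
  by (simp add: H_def)

lemma H_minus: "H (- d) n = H d n"
  by (simp add: H_eq_walks walks_minus)

text \<open>
  This is the ratio \<open>(n - j) / (j + 1)\<close> of consecutive binomial coefficients, in a form free of
  truncation and of side conditions on \<open>d\<close>.  It yields both the closed form of the influence and the
  unimodality of \<open>H\<close> in space.
\<close>

lemma walks_ratio:
  "(int n + 1 - d) * int (walks n (d - 1)) = (int n + 1 + d) * int (walks n (d + 1))"
proof (induction n arbitrary: d)
  case 0
  then show ?case by auto
next
  case (Suc n)
  have "(int n + 2 - d) * int (walks n (d - 2)) = (int n + d) * int (walks n d)"
    using Suc[of "d - 1"] by (simp add: algebra_simps)
  moreover have "(int n - d) * int (walks n d) = (int n + 2 + d) * int (walks n (d + 2))"
    using Suc[of "d + 1"] by (simp add: algebra_simps)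
  ultimately show ?case by (simp add: algebra_simps)
qed

lemma H_ratio: "(real n + 1 - of_int d) * H (d - 1) n = (real n + 1 + of_int d) * H (d + 1) n"
proof -
  have "real_of_int ((int n + 1 - d) * int (walks n (d - 1)))
      = real_of_int ((int n + 1 + d) * int (walks n (d + 1)))"
    by (simp only: walks_ratio)
  then show ?thesis by (simp add: H_eq_walks)
qed

section \<open>Influences and convergence of the series\<close>

lemma influence_diff: "influence d (Suc n) = (H (d + 1) n - H (d - 1) n) / 2"
  by (simp add: influence_def H_Suc field_simps)

lemma influence_minus: "influence (- d) (Suc n) = - influence d (Suc n)"
proof -
  have "H (- d + 1) n = H (d - 1) n" "H (- d - 1) n = H (d + 1) n"
    using H_minus[of "d - 1" n] H_minus[of "d + 1" n] by simp_all
  then show ?thesis by (simp add: influence_diff field_simps)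
qed

lemma influence_eq: "influence d (Suc n) = - (of_int d / real (Suc n)) * H d (Suc n)"
  using H_ratio[of n d] by (simp add: influence_diff H_Suc field_simps)

lemma H_even_le_center: "H d (2 * n) \<le> H 0 (2 * n)"
proof -
  have step: "H (2 * int k) (2 * n) \<le> H 0 (2 * n)" for k
  proof (induction k)
    case (Suc k)
    let ?d = "2 * int k + 1"
    let ?m = "real (2 * n) + 1" and ?r = "real_of_int (2 * int k + 1)"
    have "(?m + ?r) * H (?d + 1) (2 * n) = (?m - ?r) * H (?d - 1) (2 * n)"
      using H_ratio[of "2 * n" ?d] by simp
    also have "\<dots> \<le> (?m + ?r) * H (?d - 1) (2 * n)"
      by (intro mult_right_mono H_nonneg) simp
    finally have "H (?d + 1) (2 * n) \<le> H (?d - 1) (2 * n)"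
      by (rule mult_left_le_imp_le) simp
    then show ?case using Suc by (simp add: algebra_simps)
  qed simp
  have half: "H d (2 * n) \<le> H 0 (2 * n)" if "d \<ge> 0" for d
  proof (cases "even d")
    case True
    then have "d = 2 * int (nat (d div 2))" using that by auto
    then show ?thesis using step by metis
  next
    case False
    then have "H d (2 * n) = 0" by (simp add: H_def)
    then show ?thesis using H_nonneg by simp
  qed
  show ?thesis
    using half[of d] half[of "- d"] by (cases "d \<ge> 0") (auto simp: H_minus)
qed

text \<open>
  The central values satisfy \<open>H(0,2n+2) = H(0,2n) (2n+1)/(2n+2)\<close>, so the left-hand side decreases in
  \<open>n\<close>, by \<open>(2n+1)(2n+3) \<le> (2n+2)^2\<close>.
\<close>

lemma H_center_bound: "(H 0 (2 * n))\<^sup>2 * (2 * real n + 1) \<le> 1"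
proof (induction n)
  case 0
  then show ?case by (simp add: H_def)
next
  case (Suc n)
  have "(2 * real n + 2) * H 2 (2 * n) = 2 * real n * H 0 (2 * n)"
    using H_ratio[of "2 * n" 1] by simp
  moreover have "H 0 (2 * Suc n) = (H 0 (2 * n) + H 2 (2 * n)) / 2"
    using H_minus[of 2 "2 * n"] by (simp add: H_Suc field_simps)
  ultimately have *: "H 0 (2 * Suc n) = H 0 (2 * n) * ((2 * real n + 1) / (2 * real n + 2))"
    by (simp add: field_simps)
  have "(2 * real n + 1) * (2 * real n + 3) \<le> (2 * real n + 2)\<^sup>2"
    by (simp add: power2_eq_square algebra_simps)
  then have le1: "(2 * real n + 1) * (2 * real n + 3) / (2 * real n + 2)\<^sup>2 \<le> 1"
    by (subst divide_le_eq_1_pos) auto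
  have "(H 0 (2 * Suc n))\<^sup>2 * (2 * real (Suc n) + 1)
      = ((H 0 (2 * n))\<^sup>2 * (2 * real n + 1))
        * ((2 * real n + 1) * (2 * real n + 3) / (2 * real n + 2)\<^sup>2)"
    unfolding * by (simp add: power2_eq_square add.commute mult.commute mult.left_commute)
  also have "\<dots> \<le> 1 * 1"
    using Suc le1 by (intro mult_mono) auto
  finally show ?case by simp
qed

lemma H_bound:
  assumes "t > 0"
  shows "H d t \<le> 1 / sqrt (real t)"
proof -
  have "H d t \<le> H 0 (2 * (t div 2))"
  proof (cases "even t")
    case True
    then show ?thesis using H_even_le_center[of d "t div 2"] by simp
  next
    case False
    then have "t = Suc (2 * (t div 2))" by simp
    then have "H d t = (H (d - 1) (2 * (t div 2)) + H (d + 1) (2 * (t div 2))) / 2"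
      using H_Suc by metis
    also have "\<dots> \<le> H 0 (2 * (t div 2))"
      using H_even_le_center[of "d - 1" "t div 2"] H_even_le_center[of "d + 1" "t div 2"] by simp
    finally show ?thesis .
  qed
  then have "(H d t)\<^sup>2 * real t \<le> (H 0 (2 * (t div 2)))\<^sup>2 * (2 * real (t div 2) + 1)"
    by (intro mult_mono power_mono H_nonneg) auto
  also have "\<dots> \<le> 1" by (rule H_center_bound)
  finally have "(H d t * sqrt (real t))\<^sup>2 \<le> 1\<^sup>2" by (simp add: power_mult_distrib)
  then have "H d t * sqrt (real t) \<le> 1" by (rule power2_le_imp_le) simp
  then show ?thesis using assms by (simp add: field_simps)
qed

lemma t_max_pos: "y > 0 \<Longrightarrow> t_max y > 0"
proof -
  assume "y > 0"
  then have "(real y)\<^sup>2 \<ge> 1" by simp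
  then have "\<lfloor>((real y)\<^sup>2 - 4) / 3\<rfloor> \<ge> -1" by (simp add: le_floor_iff)
  then show ?thesis by (simp add: t_max_def)
qed

lemma int_t_max: "y > 0 \<Longrightarrow> int (t_max y) = (int y ^ 2 - 4) div 3 + 2"
proof -
  assume "y > 0"
  have "((real y)\<^sup>2 - 4) / 3 = real_of_int (int y ^ 2 - 4) / real_of_int 3" by simp
  then have "\<lfloor>((real y)\<^sup>2 - 4) / 3\<rfloor> = (int y ^ 2 - 4) div 3"
    by (simp only: floor_divide_of_int_eq)
  then show ?thesis using t_max_pos[OF \<open>y > 0\<close>] by (simp add: t_max_def)
qed

text \<open>
  If \<open>3\<close> does not divide \<open>y\<close>, then \<open>3\<close> divides \<open>y^2 - 4\<close> and the division preserves parity;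
  if \<open>y = 3k\<close>, then \<open>t_max y = 3k^2\<close>.
\<close>

lemma t_max_parity: "y > 0 \<Longrightarrow> even (t_max y) \<longleftrightarrow> even y"
proof -
  assume "y > 0"
  consider k where "int y = 3 * k" | k where "int y = 3 * k + 1" | k where "int y = 3 * k + 2"
  proof -
    have "int y = 3 * (int y div 3) \<or> int y = 3 * (int y div 3) + 1 \<or> int y = 3 * (int y div 3) + 2"
      by presburger
    then show thesis using that by blast
  qed
  then have "even (int (t_max y)) \<longleftrightarrow> even (int y)"
  proof cases
    case 1
    then have "int y ^ 2 - 4 = 3 * (3 * k^2 - 2) + 2"  by (simp add: power2_eq_square)
    then have "(int y ^ 2 - 4) div 3 = 3 * k^2 - 2" by simp
    then show ?thesis using 1 int_t_max[OF \<open>y > 0\<close>] by simp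
  next
    case 2
    then have "int y ^ 2 - 4 = 3 * (3 * k^2 + 2 * k - 1)" by (simp add: power2_eq_square algebra_simps)
    then have "(int y ^ 2 - 4) div 3 = 3 * k^2 + 2 * k - 1" by simp
    then show ?thesis using 2 int_t_max[OF \<open>y > 0\<close>] by simp
  next
    case 3
    then have "int y ^ 2 - 4 = 3 * (3 * k^2 + 4 * k)" by (simp add: power2_eq_square algebra_simps)
    then have "(int y ^ 2 - 4) div 3 = 3 * k^2 + 4 * k" by simp
    then show ?thesis using 3 int_t_max[OF \<open>y > 0\<close>] by simp
  qed
  then show ?thesis by simp
qed

lemma t_max_lower: "y > 0 \<Longrightarrow> real (t_max y) \<ge> (real y)\<^sup>2 / 4"
proof -
  assume y: "y > 0"
  have "3 * int (t_max y) \<ge> int y ^ 2"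
    unfolding int_t_max[OF y] by presburger
  then have "real_of_int (3 * int (t_max y)) \<ge> real_of_int (int y ^ 2)" by (simp only: of_int_le_iff)
  then show ?thesis by simp
qed

lemma c1_term_eq:
  assumes "y > 0"
  shows "c1_term y = - influence (int y) (t_max y)"
    and "c1_term y = real y / real (t_max y) * H (int y) (t_max y)"
proof -
  obtain n where n: "t_max y = Suc n" using t_max_pos[OF assms] gr0_implies_Suc by blast
  have *: "influence (int y) (t_max y) = - (real y / real (t_max y) * H (int y) (t_max y))"
    unfolding n by (simp add: influence_eq)
  have "real y / real (t_max y) * H (int y) (t_max y) \<ge> 0" by (simp add: H_nonneg)
  then show "c1_term y = real y / real (t_max y) * H (int y) (t_max y)"
    unfolding c1_term_def * abs_minus_cancel by (rule abs_of_nonneg)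
  then show "c1_term y = - influence (int y) (t_max y)"
    unfolding * minus_minus .
qed

lemma c1_term_bound:
  assumes "y > 0"
  shows "c1_term y \<le> 8 / (real y)\<^sup>2"
proof -
  have t: "(real y)\<^sup>2 / 4 \<le> real (t_max y)" by (rule t_max_lower[OF assms])
  then have "sqrt ((real y / 2)\<^sup>2) \<le> sqrt (real (t_max y))"
    by (intro real_sqrt_le_mono) (simp add: power_divide)
  then have "1 / sqrt (real (t_max y)) \<le> 1 / (real y / 2)"
    using assms by (intro divide_left_mono) (auto simp: t_max_pos)
  with H_bound[OF t_max_pos[OF assms]] have H: "H (int y) (t_max y) \<le> 2 / real y"
    by (metis divide_divide_eq_right mult.commute mult_1 order_trans)
  have "real y / real (t_max y) \<le> real y / ((real y)\<^sup>2 / 4)"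
    using t assms by (intro divide_left_mono) (auto simp: t_max_pos)
  then have "c1_term y \<le> real y / ((real y)\<^sup>2 / 4) * (2 / real y)"
    unfolding c1_term_eq(2)[OF assms] using H by (intro mult_mono) (auto simp: H_nonneg)
  also have "\<dots> = 8 / (real y)\<^sup>2" using assms by (simp add: power2_eq_square)
  finally show ?thesis .
qed

lemma summable_c1_term: "summable (\<lambda>n. c1_term (Suc n))"
proof (rule summable_comparison_test')
  show "summable (\<lambda>n. 8 * inverse ((real (Suc n))\<^sup>2))"
    using inverse_power_summable[of 2, where 'a=real]
    by (intro summable_mult) (subst summable_Suc_iff, simp)
  show "norm (c1_term (Suc n)) \<le> 8 * inverse ((real (Suc n))\<^sup>2)" if "n \<ge> 0" for n
    using c1_term_bound[of "Suc n"] by (simp add: c1_term_def field_simps)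
qed

section \<open>Runs of the machine\<close>

text \<open>
  The number of chips out of \<open>n\<close> that leave in the direction in which the arrow is \<open>a\<close>.  In the
  opposite direction the arrow reads \<open>- a\<close>, so one function serves both sides.
\<close>

definition share :: "nat \<Rightarrow> int \<Rightarrow> nat" where
  "share n a = (if a = 1 then (n + 1) div 2 else n div 2)"

fun chips :: "(int \<Rightarrow> nat) \<Rightarrow> (int \<Rightarrow> int) \<Rightarrow> nat \<Rightarrow> int \<Rightarrow> nat"
  and arrow :: "(int \<Rightarrow> nat) \<Rightarrow> (int \<Rightarrow> int) \<Rightarrow> nat \<Rightarrow> int \<Rightarrow> int" where
  "chips g a 0 x = g x"
| "chips g a (Suc t) x =
     share (chips g a t (x - 1)) (arrow g a t (x - 1))
     + share (chips g a t (x + 1)) (- arrow g a t (x + 1))"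
| "arrow g a 0 x = a x"
| "arrow g a (Suc t) x = (-1) ^ chips g a t x * arrow g a t x"

lemma share_add_double: "share (n + 2 * m) a = share n a + m"
  unfolding share_def by presburger

lemma real_share:
  "a \<in> {-1, 1} \<Longrightarrow> real (share n a) = real n / 2 + (if odd n then of_int a / 2 else 0)"
proof -
  assume "a \<in> {-1, 1}"
  moreover have "real n = 2 * real (n div 2) + real (n mod 2)"
    by (metis mult_div_mod_eq of_nat_add of_nat_mult of_nat_numeral)
  ultimately show ?thesis
    by (cases "even n") (auto simp: share_def mod_2_eq_odd add_divide_distrib)
qed

lemma arrow_pm1:
  assumes "\<And>x. a x \<in> {-1, 1}"
  shows "arrow g a t x \<in> {-1, 1}"
proof (induction t)
  case (Suc t)
  then show ?case by (cases "even (chips g a t x)") auto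
qed (use assms in simp)

lemma propp_run_chips:
  assumes "\<And>x. a x \<in> {-1, 1}"
  shows "propp_run (\<lambda>x t. chips g a t x) (\<lambda>x t. arrow g a t x)"
proof -
  have pm: "arrow g a t x \<in> {-1, 1}" for t x by (rule arrow_pm1[OF assms])
  then have pm': "- arrow g a t x \<in> {-1, 1}" for t x
    by (smt (verit) insert_iff singletonD)
  show ?thesis
    unfolding propp_run_def
    using pm by (auto simp: real_share[OF pm] real_share[OF pm'] field_simps odd_iff_mod_2_eq_one)
qed

lemma chips_parity:
  assumes "even_config g"
  shows "odd (int t - x) \<Longrightarrow> chips g a t x = 0"
proof (induction t arbitrary: x)
  case 0
  then show ?case using assms by (simp add: even_config_def)
next
  case (Suc t)
  have "chips g a t (x - 1) = 0" "chips g a t (x + 1) = 0"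
    using Suc.prems by (auto intro!: Suc.IH)
  then show ?case by (simp add: share_def)
qed

section \<open>Forcing parities\<close>

text \<open>
  Adding an even number of chips to a pile sends one half each way whatever the arrow, and flips
  no arrow.  The added pile \<open>2^T\<close> stays divisible by \<open>2\<close> at all vertices during its first \<open>T\<close>
  steps, so it evolves linearly and independently of the chips already there.
\<close>

lemma add_power_of_two:
  assumes "t \<le> T"
  shows "chips (g(v := g v + 2 ^ T)) a t x = chips g a t x + 2 ^ (T - t) * walks t (x - v)
       \<and> arrow (g(v := g v + 2 ^ T)) a t x = arrow g a t x"
  using assms
proof (induction t arbitrary: x)
  case 0
  then show ?case by simp
next
  case (Suc t)
  define g' where "g' = g(v := g v + 2 ^ T)"
  have pow: "(2::nat) ^ (T - t) = 2 * 2 ^ (T - Suc t)"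
    using Suc.prems by (metis Suc_diff_Suc Suc_le_lessD power_Suc)
  have c: "chips g' a t z = chips g a t z + 2 * (2 ^ (T - Suc t) * walks t (z - v))" for z
    using Suc.IH[of z] Suc.prems unfolding g'_def pow by (simp add: mult.assoc del: fun_upd_apply)
  have r: "arrow g' a t z = arrow g a t z" for z
    using Suc.IH[of z] Suc.prems by (simp add: g'_def del: fun_upd_apply)
  have "chips g' a (Suc t) x = chips g a (Suc t) x + 2 ^ (T - Suc t) * walks (Suc t) (x - v)"
    by (simp add: c r share_add_double algebra_simps)
  moreover have "arrow g' a (Suc t) x = arrow g a (Suc t) x"
    by (simp add: c r power_add power_mult)
  ultimately show ?case unfolding g'_def by (rule conjI)
qed

text \<open>
  The window is corrected from left to right.  A pile of \<open>2^T\<close> chips at \<open>y + T\<close> has a single chip at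
  its left end \<open>y\<close> at time \<open>T\<close>, so it flips the parity at \<open>y\<close> and spares everything to the left.  It
  leaves the configuration even, as \<open>y + T\<close> is even whenever \<open>y\<close> can hold chips at time \<open>T\<close>.
\<close>

lemma parity_forcing_one_time:
  fixes P :: "nat \<Rightarrow> int \<Rightarrow> bool"
  assumes "even_config g"
  shows "\<exists>g'. even_config g' \<and>
    (\<forall>t<T. \<forall>x. even (chips g' a t x) \<longleftrightarrow> even (chips g a t x)) \<and>
    (\<forall>x\<in>{l..<l + int k}. even (int T - x) \<longrightarrow> (odd (chips g' a T x) \<longleftrightarrow> P T x))"
proof (induction k)
  case 0
  show ?case using assms by auto
next
  case (Suc k)
  then obtain g1 where g1: "even_config g1"
    "\<And>t x. t < T \<Longrightarrow> even (chips g1 a t x) \<longleftrightarrow> even (chips g a t x)"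
    "\<And>x. x \<in> {l..<l + int k} \<Longrightarrow> even (int T - x) \<Longrightarrow> odd (chips g1 a T x) \<longleftrightarrow> P T x"
    by blast
  define y where "y = l + int k"
  have old_or_y: "x \<in> {l..<l + int k} \<or> x = y" if "x \<in> {l..<l + int (Suc k)}" for x
    using that by (auto simp: y_def)
  show ?case
  proof (cases "even (int T - y) \<longrightarrow> (odd (chips g1 a T y) \<longleftrightarrow> P T y)")
    case True
    then show ?thesis using g1 old_or_y by blast
  next
    case False
    define v where "v = y + int T"
    define g2 where "g2 = g1(v := g1 v + 2 ^ T)"
    have "even v" using False by (simp add: v_def)
    then have even: "even_config g2" using g1(1) by (auto simp: g2_def even_config_def)
    have c: "chips g2 a t x = chips g1 a t x + 2 ^ (T - t) * walks t (x - v)" if "t \<le> T" for t x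
      using add_power_of_two[OF that] by (simp add: g2_def)
    have "even (chips g2 a t x) \<longleftrightarrow> even (chips g a t x)" if "t < T" for t x
      using that c[of t x] g1(2)[OF that, of x] by simp
    moreover have "chips g2 a T x = chips g1 a T x" if "x < y" for x
      using that c[of T x] by (simp add: v_def walks_outside)
    moreover have "chips g2 a T y = chips g1 a T y + 1"
      using c[of T y] walks_leftmost[of T] by (simp add: v_def)
    ultimately have "odd (chips g2 a T x) \<longleftrightarrow> P T x"
      if "x \<in> {l..<l + int (Suc k)}" "even (int T - x)" for x
      using old_or_y[OF that(1)] g1(3)[of x] that(2) False by (auto simp: y_def)
    then show ?thesis
      using even \<open>\<And>t x. t < T \<Longrightarrow> even (chips g2 a t x) \<longleftrightarrow> even (chips g a t x)\<close> by blast
  qed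
qed

lemma parity_forcing:
  fixes P :: "nat \<Rightarrow> int \<Rightarrow> bool"
  shows "\<exists>g. even_config g \<and>
    (\<forall>t<T. \<forall>x\<in>{l..<l + int k}. even (int t - x) \<longrightarrow> (odd (chips g a t x) \<longleftrightarrow> P t x))"
proof (induction T)
  case 0
  have "even_config (\<lambda>_. 0)" by (simp add: even_config_def)
  then show ?case by blast
next
  case (Suc T)
  then obtain g where g: "even_config g"
    "\<forall>t<T. \<forall>x\<in>{l..<l + int k}. even (int t - x) \<longrightarrow> (odd (chips g a t x) \<longleftrightarrow> P t x)" by blast
  from parity_forcing_one_time[OF g(1), of T a l k P] obtain g' where "even_config g'"
    "\<forall>t<T. \<forall>x. even (chips g' a t x) \<longleftrightarrow> even (chips g a t x)"
    "\<forall>x\<in>{l..<l + int k}. even (int T - x) \<longrightarrow> (odd (chips g' a T x) \<longleftrightarrow> P T x)" by blast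
  with g(2) show ?case by (intro exI[of _ g']) (auto simp: less_Suc_eq)
qed

section \<open>The discrepancy as a sum of influences\<close>

lemma sum_shift_int:
  fixes h :: "int \<Rightarrow> real"
  assumes "finite S" "\<And>y. h y \<noteq> 0 \<Longrightarrow> y \<in> S \<and> y - k \<in> S"
  shows "(\<Sum>y\<in>S. h (y + k)) = (\<Sum>y\<in>S. h y)"
proof -
  have "(\<Sum>y\<in>S. h (y + k)) = (\<Sum>y\<in>(\<lambda>y. y + k) ` S. h y)"
    by (simp add: sum.reindex inj_on_def)
  also have "\<dots> = (\<Sum>y\<in>S. h y)"
  proof (rule sum.mono_neutral_cong)
    show "h y = 0" if "y \<in> S - (\<lambda>y. y + k) ` S" for y
      using that assms(2)[of y] by (force intro: image_eqI[of _ _ "y - k"])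
    show "h y = 0" if "y \<in> (\<lambda>y. y + k) ` S - S" for y
      using that assms(2)[of y] by auto
  qed (use assms(1) in auto)
  finally show ?thesis .
qed

text \<open>
  The quantity \<open>E s\<close> in the proof is the expected number of chips at \<open>x\<close> at time \<open>t\<close> when the machine
  runs for \<open>s\<close> steps and random walks take over.  It leads from \<open>expected_chips\<close> at \<open>s = 0\<close> to the
  actual count at \<open>s = t\<close>.  One step changes it only through the extra chips of odd piles, each of which
  walks from \<open>y + ARR(y,s)\<close> at time \<open>s + 1\<close> instead of from \<open>y\<close> at time \<open>s\<close>.
\<close>

lemma discrepancy:
  assumes a: "\<And>x. a x \<in> {-1, 1}"
  shows "real (chips g a t x) - expected_chips g x t
    = - (\<Sum>s<t. \<Sum>y\<in>{x - int t..x + int t}.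
          if odd (chips g a s y) then of_int (arrow g a s y) * influence (x - y) (t - s) else 0)"
proof -
  define D where "D = {x - int t..x + int t}"
  define E where "E s = (\<Sum>y\<in>D. real (chips g a s y) * H (x - y) (t - s))" for s
  have pm: "arrow g a s y \<in> {-1, 1}" for s y by (rule arrow_pm1[OF a])
  then have pm': "- arrow g a s y \<in> {-1, 1}" for s y
    by (smt (verit) insert_iff singletonD)
  have step: "E (Suc s) - E s = - (\<Sum>y\<in>D.
      if odd (chips g a s y) then of_int (arrow g a s y) * influence (x - y) (t - s) else 0)"
    if "s < t" for s
  proof -
    define n where "n = t - Suc s"
    have n: "t - s = Suc n" "n < t" using that by (auto simp: n_def)
    define r where "r y = real (share (chips g a s y) (arrow g a s y))" for y
    define l where "l y = real (share (chips g a s y) (- arrow g a s y))" for y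
    have supp: "\<bar>x - y\<bar> \<le> int n" if "H (x - y) n \<noteq> 0" for y
      using that H_outside[of n "x - y"] by linarith
    have "E (Suc s) = (\<Sum>y\<in>D. r (y - 1) * H (x - y) n) + (\<Sum>y\<in>D. l (y + 1) * H (x - y) n)"
      by (simp add: E_def r_def l_def n_def sum.distrib distrib_right)
    also have "(\<Sum>y\<in>D. r (y - 1) * H (x - y) n) = (\<Sum>y\<in>D. r y * H (x - y - 1) n)"
      using sum_shift_int[of D "\<lambda>y. r (y - 1) * H (x - y) n" 1] supp n(2)
      by (force simp: D_def algebra_simps)
    also have "(\<Sum>y\<in>D. l (y + 1) * H (x - y) n) = (\<Sum>y\<in>D. l y * H (x - y + 1) n)"
      using sum_shift_int[of D "\<lambda>y. l (y + 1) * H (x - y) n" "-1"] supp n(2)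
      by (force simp: D_def algebra_simps)
    finally have "E (Suc s) - E s = (\<Sum>y\<in>D. r y * H (x - y - 1) n + l y * H (x - y + 1) n
        - real (chips g a s y) * H (x - y) (Suc n))"
      by (simp add: E_def n sum.distrib sum_subtractf)
    also have "\<dots> = (\<Sum>y\<in>D. - (if odd (chips g a s y)
        then of_int (arrow g a s y) * influence (x - y) (t - s) else 0))"
      unfolding n r_def l_def real_share[OF pm] real_share[OF pm'] H_Suc influence_diff
      by (intro sum.cong refl) (simp add: field_simps)
    finally show ?thesis by (simp add: sum_negf)
  qed
  have "E t = real (chips g a t x)"
  proof -
    have "E t = (\<Sum>y\<in>D. if y = x then real (chips g a t x) else 0)"
      unfolding E_def by (intro sum.cong) (auto simp: H_def)
    then show ?thesis by (simp add: D_def)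
  qed
  moreover have "E 0 = expected_chips g x t"
  proof -
    have "(\<Sum>\<^sub>\<infinity>y\<in>UNIV. real (g y) * H (x - y) t) = (\<Sum>\<^sub>\<infinity>y\<in>D. real (g y) * H (x - y) t)"
      by (rule infsum_cong_neutral) (auto simp: D_def H_outside)
    then show ?thesis by (simp add: E_def expected_chips_def D_def)
  qed
  moreover have "E t - E 0 = (\<Sum>s<t. E (Suc s) - E s)" by (simp add: sum_lessThan_telescope)
  ultimately show ?thesis
    using step by (simp add: D_def sum_negf)
qed

section \<open>The extremal configuration\<close>

lemma attain_partial_sum:
  "\<exists>(f :: int \<Rightarrow> nat \<Rightarrow> nat) (ARR :: int \<Rightarrow> nat \<Rightarrow> int) t.
     propp_run f ARR \<and> even_config (\<lambda>y. f y 0) \<and>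
     real (f 0 t) - expected_chips (\<lambda>y. f y 0) 0 t = 2 * (\<Sum>n<L. c1_term (Suc n))"
proof -
  define a :: "int \<Rightarrow> int" where "a y = (if y > 0 then -1 else 1)" for y
  have a: "a y \<in> {-1, 1}" for y by (simp add: a_def)
  \<comment> \<open>Any even number bounding \<open>L\<close> and all \<open>t_max y\<close> with \<open>y \<le> L\<close> would do.\<close>
  define t where "t = 2 * (L + (\<Sum>y\<le>L. t_max y))"
  have "L \<le> t" by (simp add: t_def)
  have t_ge: "t_max y \<le> t" if "y \<le> L" for y
    using member_le_sum[of y "{..L}" t_max] that by (simp add: t_def)
  define P where "P s y \<longleftrightarrow> y \<noteq> 0 \<and> \<bar>y\<bar> \<le> int L \<and> s + t_max (nat \<bar>y\<bar>) = t" for s y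
  \<comment> \<open>Vertices farther than \<open>t\<close> from \<open>0\<close> cannot influence the count at \<open>0\<close>.\<close>
  obtain g where g: "even_config g" "\<And>s y. s < t \<Longrightarrow> y \<in> {- int t..<- int t + int (2 * t + 1)} \<Longrightarrow>
      even (int s - y) \<Longrightarrow> odd (chips g a s y) \<longleftrightarrow> P s y"
    using parity_forcing[of t "- int t" "2 * t + 1" a P] by blast
  have P_parity: "even (int s - y)" if "P s y" for s y
  proof -
    have "even (s + t_max (nat \<bar>y\<bar>))" using that by (simp add: P_def t_def)
    moreover have "even (t_max (nat \<bar>y\<bar>)) \<longleftrightarrow> even (nat \<bar>y\<bar>)"
      using that by (intro t_max_parity) (simp add: P_def)
    ultimately show ?thesis by (simp add: even_nat_iff)
  qed
  have odd_iff: "odd (chips g a s y) \<longleftrightarrow> P s y" if "s < t" "\<bar>y\<bar> \<le> int t" for s y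
  proof (cases "even (int s - y)")
    case True
    then show ?thesis using g(2)[OF that(1), of y] that(2) by (simp add: abs_le_iff)
  next
    case False
    then show ?thesis using chips_parity[OF g(1) False] P_parity by auto
  qed
  \<comment> \<open>No pile at \<open>y\<close> is odd before the prescribed time, so the arrow has not moved yet.\<close>
  have arrow: "arrow g a s y = a y" if "P s y" for s y
  proof -
    have y: "\<bar>y\<bar> \<le> int t" using that \<open>L \<le> t\<close> by (simp add: P_def)
    have "s' \<le> s \<Longrightarrow> arrow g a s' y = a y" for s'
    proof (induction s')
      case (Suc s')
      have "\<not> P s' y" "s' < t" using that Suc.prems by (auto simp: P_def)
      then have "even (chips g a s' y)" using odd_iff[of s' y] y by blast
      then show ?case using Suc by simp
    qed simp
    then show ?thesis by simp
  qed
  have col: "(\<Sum>s<t. if odd (chips g a s y) then of_int (arrow g a s y) * influence (0 - y) (t - s) else 0)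
      = (if y \<noteq> 0 \<and> \<bar>y\<bar> \<le> int L then - c1_term (nat \<bar>y\<bar>) else 0)"
    if y: "y \<in> {- int t..int t}" for y
  proof (cases "y \<noteq> 0 \<and> \<bar>y\<bar> \<le> int L")
    case True
    define m where "m = nat \<bar>y\<bar>"
    have m: "m > 0" "m \<le> L" using True by (auto simp: m_def)
    have u: "t_max m > 0" "t_max m \<le> t" using t_max_pos[OF m(1)] t_ge[OF m(2)] by auto
    have P: "P s y \<longleftrightarrow> s = t - t_max m" for s
      using True u by (auto simp: P_def m_def)
    obtain n where n: "t_max m = Suc n" using u(1) gr0_implies_Suc by blast
    \<comment> \<open>The influence is odd in its first argument, and so is the choice of the arrows.\<close>
    have val: "of_int (a y) * influence (- y) (t_max m) = - c1_term m"
    proof (cases "y > 0")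
      case True
      then have "y = int m" by (simp add: m_def)
      then show ?thesis using c1_term_eq(1)[OF m(1)] m(1)
        by (simp add: a_def n influence_minus)
    next
      case False
      then have "- y = int m" by (simp add: m_def)
      then show ?thesis using c1_term_eq(1)[OF m(1)] False by (simp add: a_def)
    qed
    have "(\<Sum>s<t. if odd (chips g a s y) then of_int (arrow g a s y) * influence (0 - y) (t - s) else 0)
        = (\<Sum>s<t. if s = t - t_max m then - c1_term m else 0)"
    proof (intro sum.cong refl)
      fix s assume "s \<in> {..<t}"
      then have "odd (chips g a s y) \<longleftrightarrow> P s y" using y by (intro odd_iff) auto
      show "(if odd (chips g a s y) then of_int (arrow g a s y) * influence (0 - y) (t - s) else 0)
          = (if s = t - t_max m then - c1_term m else 0)"
      proof (cases "P s y")
        case True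
        then have "s = t - t_max m" "t - s = t_max m" using P u by auto
        then show ?thesis using \<open>odd _ \<longleftrightarrow> _\<close> True arrow[OF True] val by simp
      next
        case False
        then show ?thesis using \<open>odd _ \<longleftrightarrow> _\<close> P by simp
      qed
    qed
    also have "\<dots> = - c1_term m" using u by simp
    finally show ?thesis using True by (simp add: m_def)
  next
    case False
    then have "\<not> P s y" for s by (auto simp: P_def)
    then show ?thesis using odd_iff y False by (auto intro!: sum.neutral)
  qed
  have "real (chips g a t 0) - expected_chips g 0 t
      = - (\<Sum>y\<in>{- int t..int t}. \<Sum>s<t.
            if odd (chips g a s y) then of_int (arrow g a s y) * influence (0 - y) (t - s) else 0)"
    using discrepancy[OF a, where g=g and t=t and x=0] by (subst sum.swap) simp
  also have "\<dots> = - (\<Sum>y\<in>{- int t..int t}.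
      if y \<noteq> 0 \<and> \<bar>y\<bar> \<le> int L then - c1_term (nat \<bar>y\<bar>) else 0)"
    by (simp only: col cong: sum.cong)
  also have "\<dots> = (\<Sum>y\<in>{1..int L} \<union> {- int L..-1}. c1_term (nat \<bar>y\<bar>))"
    unfolding sum_negf[symmetric]
    by (rule sum.mono_neutral_cong_right) (use \<open>L \<le> t\<close> in auto)
  also have "\<dots> = (\<Sum>y\<in>{1..int L}. c1_term (nat \<bar>y\<bar>)) + (\<Sum>y\<in>{- int L..-1}. c1_term (nat \<bar>y\<bar>))"
    by (rule sum.union_disjoint) auto
  also have "(\<Sum>y\<in>{1..int L}. c1_term (nat \<bar>y\<bar>)) = (\<Sum>n<L. c1_term (Suc n))"
    by (rule sum.reindex_bij_witness[of _ "\<lambda>n. int n + 1" "\<lambda>y. nat (y - 1)"])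
       (auto simp: nat_add_distrib Suc_nat_eq_nat_zadd1)
  also have "(\<Sum>y\<in>{- int L..-1}. c1_term (nat \<bar>y\<bar>)) = (\<Sum>n<L. c1_term (Suc n))"
    by (rule sum.reindex_bij_witness[of _ "\<lambda>n. - int n - 1" "\<lambda>y. nat (- y - 1)"])
       (auto simp: nat_add_distrib Suc_nat_eq_nat_zadd1)
  finally have "real (chips g a t 0) - expected_chips g 0 t = 2 * (\<Sum>n<L. c1_term (Suc n))"
    by simp
  then show ?thesis using propp_run_chips[OF a, of g] g(1)
    by (intro exI[of _ "\<lambda>x t. chips g a t x"] exI[of _ "\<lambda>x t. arrow g a t x"] exI[of _ t]) simp
qed

theorem mainTheorem4:
  "summable (\<lambda>n. c1_term (Suc n)) \<and>
   (\<forall>c::real. c < c1 \<longrightarrow>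
      (\<exists>(f :: int \<Rightarrow> nat \<Rightarrow> nat) (ARR :: int \<Rightarrow> nat \<Rightarrow> int) (t :: nat) (x :: int).
          propp_run f ARR \<and> even_config (\<lambda>y. f y 0) \<and>
          \<bar>real (f x t) - expected_chips (\<lambda>y. f y 0) x t\<bar> > c))"
proof (intro conjI allI impI)
  show "summable (\<lambda>n. c1_term (Suc n))" by (rule summable_c1_term)
  fix c :: real
  assume "c < c1"
  have "(\<lambda>L. 2 * (\<Sum>n<L. c1_term (Suc n))) \<longlonglongrightarrow> c1"
    unfolding c1_def by (intro tendsto_mult_left summable_LIMSEQ summable_c1_term)
  then have "\<forall>\<^sub>F L in sequentially. c < 2 * (\<Sum>n<L. c1_term (Suc n))"
    using \<open>c < c1\<close> by (rule order_tendstoD)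
  then obtain L where L: "c < 2 * (\<Sum>n<L. c1_term (Suc n))"
    by (auto simp: eventually_sequentially)
  obtain f :: "int \<Rightarrow> nat \<Rightarrow> nat" and ARR :: "int \<Rightarrow> nat \<Rightarrow> int" and t where
    "propp_run f ARR" "even_config (\<lambda>y. f y 0)"
    "real (f 0 t) - expected_chips (\<lambda>y. f y 0) 0 t = 2 * (\<Sum>n<L. c1_term (Suc n))"
    using attain_partial_sum by blast
  then show "\<exists>(f :: int \<Rightarrow> nat \<Rightarrow> nat) (ARR :: int \<Rightarrow> nat \<Rightarrow> int) (t :: nat) (x :: int).
      propp_run f ARR \<and> even_config (\<lambda>y. f y 0) \<and>
      \<bar>real (f x t) - expected_chips (\<lambda>y. f y 0) x t\<bar> > c"
    using L by (intro exI[of _ f] exI[of _ ARR] exI[of _ t] exI[of _ 0]) auto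
qed

end
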